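(* Let $A,B\in\mathbb{R}^{m\times n}$ with $n=m$, let $c\in\mathbb{R}^m$, let $f(x,y)=\|Ax-By-c\|_2^2$, and let $g\colon\mathbb{R}^m\to\mathbb{R}^m$ be continuous and differentiable. Consider the optimisation problem $$\min_{x,y} f(x,y)\quad\text{subject to}\quad y=g(x),$$ and define $h(y)=\operatorname{argmin}_x f(x,y)$. Assume that (1) $A$ and $B$ are full rank matrices, and (2) $g$ is surjective. If $y^*$ satisfies $y^*=g(h(y^* ))$ and $x^*=h(y^* )$, then $(x^*,y^* )$ is a solution (global minimiser) of the optimisation problem.
   Context: Here $x,y$ range over $\mathbb{R}^m$ and $\|\cdot\|_2$ is the Euclidean norm. Since $A$ is of full rank, $h(y)$ is the unique linear least squares solution, $h(y)=A^{\dagger}(By+c)$, where $A^\dagger$ is the Moore–Penrose pseudoinverse. *)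

theory Defs
  imports "HOL-Analysis.Analysis"
begin

definition objective ::
  "real ^ 'n ^ 'm \<Rightarrow> real ^ 'n ^ 'm \<Rightarrow> real ^ 'm \<Rightarrow> real ^ 'n \<Rightarrow> real ^ 'n \<Rightarrow> real"
  where "objective A B c x y = (norm (A *v x - B *v y - c))\<^sup>2"

text \<open>
  The library's \<^const>\<open>arg_min\<close> selects some minimiser. When \<open>A\<close> has full column rank the
  least-squares minimiser exists and is unique, so the selection is then determined.
\<close>

definition least_squares_solution ::
  "real ^ 'n ^ 'm \<Rightarrow> real ^ 'n ^ 'm \<Rightarrow> real ^ 'm \<Rightarrow> real ^ 'n \<Rightarrow> real ^ 'n"
  where "least_squares_solution A B c y = (ARG_MIN (\<lambda>x. objective A B c x y) x. True)"

end

theory Submission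
  imports Defs
begin

text \<open>
  A square matrix of full rank is surjective, so for every \<open>y\<close> the residual \<open>A x - B y - c\<close> can be
  made to vanish, and a least squares solution is an exact one. The objective is a squared norm,
  so \<open>0\<close> is a lower bound for it on the whole space. The pair \<open>(x_star, y_star)\<close> attains this
  bound, and the fixed-point equation for \<open>y_star\<close> says precisely that the pair is feasible:
  it minimises the objective even without the constraint, hence also subject to it.
\<close>

text \<open>
  Existence of a zero of the residual is what makes the choice made by \<^const>\<open>arg_min\<close> meaningful:
  every minimiser then has value at most \<open>0\<close>. Full row rank suffices for this, even where
  minimisers are not unique.
\<close>

lemma objective_least_squares_solution_eq_0:
  fixes A B :: "real ^ 'n ^ 'm"
  assumes "rank A = CARD('m)"
  shows "objective A B c (least_squares_solution A B c y) y = 0"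
proof -
  have "surj ((*v) A)"
    using assms by (simp add: full_rank_surjective)
  then obtain x where "A *v x = B *v y + c"
    by (metis surjD)
  then have x: "objective A B c x y = 0"
    by (simp add: objective_def)
  then have "is_arg_min (\<lambda>x. objective A B c x y) (\<lambda>_. True) x"
    by (simp add: is_arg_min_linorder objective_def)
  then have "is_arg_min (\<lambda>x. objective A B c x y) (\<lambda>_. True) (least_squares_solution A B c y)"
    unfolding least_squares_solution_def arg_min_def by (rule someI)
  then have "objective A B c (least_squares_solution A B c y) y \<le> objective A B c x y"
    by (simp add: is_arg_min_linorder)
  with x show ?thesis
    by (simp add: objective_def)
qed

theorem lemma1:
  fixes A B :: "real ^ 'm ^ 'm"
    and c :: "real ^ 'm"
    and g :: "real ^ 'm \<Rightarrow> real ^ 'm"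
    and x_star y_star :: "real ^ 'm"
  assumes "continuous_on UNIV g"
    and "g differentiable_on UNIV"
    and "rank A = CARD('m)"
    and "rank B = CARD('m)"
    and "surj g"
    and "y_star = g (least_squares_solution A B c y_star)"
    and "x_star = least_squares_solution A B c y_star"
  shows "is_arg_min (\<lambda>(x, y). objective A B c x y) (\<lambda>(x, y). y = g x) (x_star, y_star)"
proof -
  have "objective A B c x_star y_star = 0"
    using assms(3,7) by (simp add: objective_least_squares_solution_eq_0)
  moreover have "y_star = g x_star"
    using assms(6,7) by simp
  moreover have "0 \<le> objective A B c x y" for x y
    by (simp add: objective_def)
  ultimately show ?thesis
    by (auto simp: is_arg_min_linorder)
qed

end
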